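(* Every FG-quasigroup is linear over a group. That is, if $(Q,\cdot)$ is an FG-quasigroup, then there exist a (possibly noncommutative) group operation $+$ on the set $Q$, automorphisms $f,g$ of $(Q,+)$, and an element $e\in Q$ such that $xy=f(x)+e+g(y)$ for all $x,y\in Q$.
   Context: A quasigroup is a non-empty set $Q$ with a binary operation (written multiplicatively) such that all left translations $L_a:x\mapsto ax$ and all right translations $R_a:x\mapsto xa$ are permutations of $Q$. Juxtaposition binds more tightly than $\cdot$, so $xy\cdot zw$ means $(xy)(zw)$. In a quasigroup the maps $\alpha,\beta:Q\to Q$ are defined by $x\,\alpha(x)=x=\beta(x)\,x$. $Q$ is a left F-quasigroup if $x\cdot yz = xy\cdot\alpha(x)z$ for all $x,y,z\in Q$; a right F-quasigroup if $zy\cdot x = z\beta(x)\cdot yx$ for all $x,y,z\in Q$; an F-quasigroup if it is both. A quasigroup $(Q,\cdot)$ is isotopic to a group $(G,+)$ if there are bijections $a,b,c:Q\to G$ with $c(xy)=a(x)+b(y)$ for all $x,y\in Q$. An FG-quasigroup is an F-quasigroup isotopic to a (possibly noncommutative) group. Groups are written additively even when noncommutative. *)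

theory Defs
  imports "HOL-Algebra.Group"
begin

text \<open>
  Quasigroups are given by a carrier set and a binary operation; only the values of the operation
  on the carrier matter.  Groups are those of HOL-Algebra, hence written multiplicatively:
  the additive \<open>a + b\<close> of a possibly noncommutative group is \<open>a \<otimes>\<^bsub>G\<^esub> b\<close> here.
\<close>

locale quasigroup =
  fixes Q :: "'a set" and mul :: "'a \<Rightarrow> 'a \<Rightarrow> 'a" (infixl \<open>\<cdot>\<close> 70)
  assumes nonempty: "Q \<noteq> {}"
    and left_translation: "a \<in> Q \<Longrightarrow> bij_betw (\<lambda>x. a \<cdot> x) Q Q"
    and right_translation: "a \<in> Q \<Longrightarrow> bij_betw (\<lambda>x. x \<cdot> a) Q Q"
begin

text \<open>In a quasigroup the elements described here exist and are unique for \<open>x \<in> Q\<close>.\<close>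

definition \<alpha> :: "'a \<Rightarrow> 'a" where
  "\<alpha> x = (THE u. u \<in> Q \<and> x \<cdot> u = x)"

definition \<beta> :: "'a \<Rightarrow> 'a" where
  "\<beta> x = (THE u. u \<in> Q \<and> u \<cdot> x = x)"

end

locale left_F_quasigroup = quasigroup +
  assumes left_F: "\<lbrakk>x \<in> Q; y \<in> Q; z \<in> Q\<rbrakk> \<Longrightarrow> x \<cdot> (y \<cdot> z) = (x \<cdot> y) \<cdot> (\<alpha> x \<cdot> z)"

locale right_F_quasigroup = quasigroup +
  assumes right_F: "\<lbrakk>x \<in> Q; y \<in> Q; z \<in> Q\<rbrakk> \<Longrightarrow> (z \<cdot> y) \<cdot> x = (z \<cdot> \<beta> x) \<cdot> (y \<cdot> x)"

locale F_quasigroup = left_F_quasigroup + right_F_quasigroup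

definition isotopic_to_group ::
    "'a set \<Rightarrow> ('a \<Rightarrow> 'a \<Rightarrow> 'a) \<Rightarrow> ('b, 'm) monoid_scheme \<Rightarrow> bool" where
  "isotopic_to_group Q mul G \<longleftrightarrow> group G \<and>
     (\<exists>a b c. bij_betw a Q (carrier G) \<and> bij_betw b Q (carrier G) \<and> bij_betw c Q (carrier G) \<and>
        (\<forall>x\<in>Q. \<forall>y\<in>Q. c (mul x y) = a x \<otimes>\<^bsub>G\<^esub> b y))"

text \<open>
  HOL has no quantification over types inside a formula, so the type \<open>'b\<close> in which the elements of
  the isotopic group live is a parameter; a statement with \<open>'b\<close> free is about groups on any type.
\<close>

definition FG_quasigroup :: "'b itself \<Rightarrow> 'a set \<Rightarrow> ('a \<Rightarrow> 'a \<Rightarrow> 'a) \<Rightarrow> bool" where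
  "FG_quasigroup (_ :: 'b itself) Q mul \<longleftrightarrow>
     F_quasigroup Q mul \<and> (\<exists>G :: 'b monoid. isotopic_to_group Q mul G)"

end

theory Submission imports Defs "HOL-Algebra.Weak_Morphisms" begin

text \<open>
  Transporting the group structure along the bijection on the values of the product turns the
  isotopy into a principal one: there is a group \<open>H\<close> on the set \<open>Q\<close> itself and there are
  permutations \<open>P\<close>, \<open>R\<close> of \<open>Q\<close> with \<open>x \<cdot> y = P x \<otimes> R y\<close>.  Rewriting the left F-law in \<open>H\<close>, with
  \<open>y\<close> and \<open>z\<close> for \<open>P y\<close> and \<open>R z\<close>, gives, for one fixed \<open>x\<close>,
  \<open>P x \<otimes> R (y \<otimes> z) = P (\<dots>) \<otimes> R (P (\<alpha> x) \<otimes> z)\<close>, where the omitted term depends on \<open>y\<close> only.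
  Replacing \<open>y\<close> by \<open>y \<otimes> P (\<alpha> x)\<close> and \<open>z\<close> by \<open>inv (P (\<alpha> x)) \<otimes> z\<close> absorbs the constant, so that
  \<open>R (y \<otimes> z)\<close> has the form \<open>A y \<otimes> R z\<close>.  This forces \<open>R\<close> to be an automorphism up to a translation, namely
  \<open>R y = R \<one> \<otimes> g y\<close>.  Dually, the right F-law gives \<open>P x = f x \<otimes> P \<one>\<close> with an automorphism \<open>f\<close>,
  and so \<open>x \<cdot> y = f x \<otimes> (P \<one> \<otimes> R \<one>) \<otimes> g y\<close>.
\<close>

section \<open>Quasigroups and their principal isotopes\<close>

context quasigroup
begin

lemma mul_closed: "x \<in> Q \<Longrightarrow> y \<in> Q \<Longrightarrow> x \<cdot> y \<in> Q"
  using left_translation bij_betwE by metis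

lemma \<alpha>_closed:
  assumes "x \<in> Q"
  shows "\<alpha> x \<in> Q"
proof -
  have bij: "bij_betw (\<lambda>u. x \<cdot> u) Q Q"
    using assms by (rule left_translation)
  then obtain u where "u \<in> Q" "x \<cdot> u = x"
    using assms unfolding bij_betw_def by (metis imageE)
  then have "\<exists>!u. u \<in> Q \<and> x \<cdot> u = x"
    using bij unfolding bij_betw_def by (metis inj_onD)
  then show ?thesis
    unfolding \<alpha>_def by (rule theI'[THEN conjunct1])
qed

lemma \<beta>_closed:
  assumes "x \<in> Q"
  shows "\<beta> x \<in> Q"
proof -
  have bij: "bij_betw (\<lambda>u. u \<cdot> x) Q Q"
    using assms by (rule right_translation)
  then obtain u where "u \<in> Q" "u \<cdot> x = x"
    using assms unfolding bij_betw_def by (metis imageE)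
  then have "\<exists>!u. u \<in> Q \<and> u \<cdot> x = x"
    using bij unfolding bij_betw_def by (metis inj_onD)
  then show ?thesis
    unfolding \<beta>_def by (rule theI'[THEN conjunct1])
qed

text \<open>
  The group is carried over to \<open>Q\<close> along \<open>c\<close>, the bijection on the values of the product, since
  then the product in \<open>Q\<close> is the new group operation applied to permuted arguments.
\<close>

lemma principal_isotope:
  assumes "isotopic_to_group Q (\<cdot>) G"
  obtains H :: "'a monoid" and P R where
    "group H" "carrier H = Q" "bij_betw P Q Q" "bij_betw R Q Q"
    "\<And>x y. x \<in> Q \<Longrightarrow> y \<in> Q \<Longrightarrow> x \<cdot> y = P x \<otimes>\<^bsub>H\<^esub> R y"
proof -
  from assms obtain a b c where "group G"
    and a: "bij_betw a Q (carrier G)" and b: "bij_betw b Q (carrier G)"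
    and c: "bij_betw c Q (carrier G)"
    and isotopy: "\<And>x y. x \<in> Q \<Longrightarrow> y \<in> Q \<Longrightarrow> c (x \<cdot> y) = a x \<otimes>\<^bsub>G\<^esub> b y"
    unfolding isotopic_to_group_def by blast
  interpret G: group G by fact
  define d where "d = inv_into Q c"
  have d: "bij_betw d (carrier G) Q"
    unfolding d_def using c by (rule bij_betw_inv_into)
  then have inj: "inj_on d (carrier G)"
    by (rule bij_betw_imp_inj_on)
  have "group (image_group d G)"
    using inj by (rule G.inj_imp_image_group_is_group)
  moreover have "carrier (image_group d G) = Q"
    using d by (simp add: image_group_carrier bij_betw_def)
  moreover have "bij_betw (d \<circ> a) Q Q" "bij_betw (d \<circ> b) Q Q"
    using a b d by (auto intro: bij_betw_trans)
  moreover have "x \<cdot> y = (d \<circ> a) x \<otimes>\<^bsub>image_group d G\<^esub> (d \<circ> b) y" if "x \<in> Q" "y \<in> Q" for x y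
  proof -
    have "x \<cdot> y = d (c (x \<cdot> y))"
      unfolding d_def using c that by (simp add: bij_betw_inv_into_left mul_closed)
    also have "\<dots> = d (a x \<otimes>\<^bsub>G\<^esub> b y)"
      using that by (simp add: isotopy)
    also have "\<dots> = d (a x) \<otimes>\<^bsub>image_group d G\<^esub> d (b y)"
      using inj_imp_image_group_iso[OF inj] that a b
      by (auto simp: iso_def hom_def bij_betw_apply)
    finally show ?thesis by simp
  qed
  ultimately show thesis
    by (rule that)
qed

end

section \<open>Permutations of a group that are automorphisms up to translation\<close>

context group
begin

lemma mult_inv_mult_cancel:
  assumes "u \<in> carrier G" "k \<in> carrier G" "v \<in> carrier G"
  shows "u \<otimes> inv k \<otimes> (k \<otimes> v) = u \<otimes> v" and "u \<otimes> k \<otimes> (inv k \<otimes> v) = u \<otimes> v"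
proof -
  have "inv k \<otimes> (k \<otimes> v) = v" "k \<otimes> (inv k \<otimes> v) = v"
    using assms by (simp_all add: m_assoc[symmetric])
  with assms show "u \<otimes> inv k \<otimes> (k \<otimes> v) = u \<otimes> v" "u \<otimes> k \<otimes> (inv k \<otimes> v) = u \<otimes> v"
    by (simp_all add: m_assoc)
qed

text \<open>
  Putting the second factor equal to \<open>\<one>\<close> identifies \<open>A y\<close> as \<open>R y \<otimes> inv (R \<one>)\<close>, and then the
  hypothesis reads \<open>R (y \<otimes> z) = R y \<otimes> inv (R \<one>) \<otimes> R z\<close>.
\<close>

lemma iso_of_left_factorization:
  assumes R: "bij_betw R (carrier G) (carrier G)"
    and A: "\<And>y. y \<in> carrier G \<Longrightarrow> A y \<in> carrier G"
    and factor: "\<And>y z. y \<in> carrier G \<Longrightarrow> z \<in> carrier G \<Longrightarrow> R (y \<otimes> z) = A y \<otimes> R z"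
  shows "(\<lambda>y. inv (R \<one>) \<otimes> R y) \<in> iso G G"
proof (rule isoI)
  have RG: "R y \<in> carrier G" if "y \<in> carrier G" for y
    using R that by (rule bij_betw_apply)
  show "(\<lambda>y. inv (R \<one>) \<otimes> R y) \<in> hom G G"
  proof (rule homI)
    fix y z assume yz: "y \<in> carrier G" "z \<in> carrier G"
    have "R y = A y \<otimes> R \<one>"
      using factor[of y \<one>] yz by simp
    then have "A y = R y \<otimes> inv (R \<one>)"
      using yz RG A by (simp add: m_assoc)
    then show "inv (R \<one>) \<otimes> R (y \<otimes> z) = inv (R \<one>) \<otimes> R y \<otimes> (inv (R \<one>) \<otimes> R z)"
      using yz RG by (simp add: factor m_assoc)
  qed (simp add: RG)
  have "bij_betw (\<lambda>u. inv (R \<one>) \<otimes> u) (carrier G) (carrier G)"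
    by (rule bij_betw_byWitness[where f' = "\<lambda>u. R \<one> \<otimes> u"])
      (auto simp: RG m_assoc[symmetric])
  with R show "bij_betw (\<lambda>y. inv (R \<one>) \<otimes> R y) (carrier G) (carrier G)"
    using bij_betw_trans by (fastforce simp: comp_def)
qed

lemma iso_of_right_factorization:
  assumes P: "bij_betw P (carrier G) (carrier G)"
    and B: "\<And>y. y \<in> carrier G \<Longrightarrow> B y \<in> carrier G"
    and factor: "\<And>z y. z \<in> carrier G \<Longrightarrow> y \<in> carrier G \<Longrightarrow> P (z \<otimes> y) = P z \<otimes> B y"
  shows "(\<lambda>y. P y \<otimes> inv (P \<one>)) \<in> iso G G"
proof (rule isoI)
  have PG: "P y \<in> carrier G" if "y \<in> carrier G" for y
    using P that by (rule bij_betw_apply)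
  show "(\<lambda>y. P y \<otimes> inv (P \<one>)) \<in> hom G G"
  proof (rule homI)
    fix z y assume zy: "z \<in> carrier G" "y \<in> carrier G"
    have "P y = P \<one> \<otimes> B y"
      using factor[of \<one> y] zy by simp
    then have "B y = inv (P \<one>) \<otimes> P y"
      using zy PG B by (simp add: m_assoc[symmetric])
    then show "P (z \<otimes> y) \<otimes> inv (P \<one>) = P z \<otimes> inv (P \<one>) \<otimes> (P y \<otimes> inv (P \<one>))"
      using zy PG by (simp add: factor m_assoc)
  qed (simp add: PG)
  have "bij_betw (\<lambda>u. u \<otimes> inv (P \<one>)) (carrier G) (carrier G)"
    by (rule bij_betw_byWitness[where f' = "\<lambda>u. u \<otimes> P \<one>"])
      (auto simp: PG m_assoc)
  with P show "bij_betw (\<lambda>y. P y \<otimes> inv (P \<one>)) (carrier G) (carrier G)"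
    using bij_betw_trans by (fastforce simp: comp_def)
qed

end

section \<open>F-laws in a principal isotope of a group\<close>

text \<open>
  The left F-law at a single, arbitrary element \<open>x\<close> already yields a factorization
  \<open>R (y \<otimes> z) = A y \<otimes> R z\<close>: on its right-hand side the variable of the first factor \<open>x \<cdot> y\<close> is
  separated from that of the second factor \<open>\<alpha> x \<cdot> z\<close>.
\<close>

lemma left_F_principal_isotope_iso:
  assumes "left_F_quasigroup Q mul" "group H" and carrier: "carrier H = Q"
    and P: "bij_betw P Q Q" and R: "bij_betw R Q Q"
    and isotopy: "\<And>x y. x \<in> Q \<Longrightarrow> y \<in> Q \<Longrightarrow> mul x y = P x \<otimes>\<^bsub>H\<^esub> R y"
  shows "(\<lambda>y. inv\<^bsub>H\<^esub> (R \<one>\<^bsub>H\<^esub>) \<otimes>\<^bsub>H\<^esub> R y) \<in> iso H H"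
proof -
  interpret left_F_quasigroup Q mul by fact
  interpret H: group H by fact
  note closed = H.m_closed[unfolded carrier] H.inv_closed[unfolded carrier]
  have PQ: "P x \<in> Q" and RQ: "R x \<in> Q" if "x \<in> Q" for x
    using that P R bij_betw_apply by metis+
  obtain x where x: "x \<in> Q"
    using nonempty by blast
  define k where "k = P (\<alpha> x)"
  have k: "k \<in> Q"
    unfolding k_def using x by (simp add: PQ \<alpha>_closed)
  define p where "p y = inv_into Q P (y \<otimes>\<^bsub>H\<^esub> k)" for y
  have p: "p y \<in> Q" "P (p y) = y \<otimes>\<^bsub>H\<^esub> k" if "y \<in> Q" for y
    using that k closed P unfolding p_def bij_betw_def
    by (auto intro: inv_into_into f_inv_into_f)
  define A where "A y = inv\<^bsub>H\<^esub> (P x) \<otimes>\<^bsub>H\<^esub> P (mul x (p y))" for y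
  have A: "A y \<in> carrier H" if "y \<in> carrier H" for y
    using that x by (simp add: A_def carrier PQ p mul_closed closed)
  have "R (y \<otimes>\<^bsub>H\<^esub> z) = A y \<otimes>\<^bsub>H\<^esub> R z" if y: "y \<in> carrier H" and z: "z \<in> carrier H" for y z
  proof -
    \<comment> \<open>The constant \<open>k\<close> is absorbed by the choice of the arguments of the F-law: \<open>P\<close> takes
      \<open>p y\<close> to \<open>y \<otimes> k\<close> and \<open>R\<close> takes \<open>w\<close> to \<open>inv k \<otimes> z\<close>.\<close>
    obtain w where w: "w \<in> Q" "R w = inv\<^bsub>H\<^esub> k \<otimes>\<^bsub>H\<^esub> z"
      using R z k closed carrier unfolding bij_betw_def by (metis imageE)
    have yz: "y \<in> Q" "z \<in> Q" using y z carrier by simp_all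
    have "y \<otimes>\<^bsub>H\<^esub> k \<otimes>\<^bsub>H\<^esub> (inv\<^bsub>H\<^esub> k \<otimes>\<^bsub>H\<^esub> z) = y \<otimes>\<^bsub>H\<^esub> z"
      using yz k by (simp add: H.mult_inv_mult_cancel carrier)
    then have 1: "mul (p y) w = y \<otimes>\<^bsub>H\<^esub> z"
      using isotopy p yz w by simp
    have "k \<otimes>\<^bsub>H\<^esub> (inv\<^bsub>H\<^esub> k \<otimes>\<^bsub>H\<^esub> z) = z"
      using yz k carrier by (metis H.inv_closed H.inv_solve_left H.m_closed)
    then have 2: "mul (\<alpha> x) w = z"
      using isotopy[of "\<alpha> x" w] \<alpha>_closed x w by (simp add: k_def)
    have "P x \<otimes>\<^bsub>H\<^esub> R (mul (p y) w) = P (mul x (p y)) \<otimes>\<^bsub>H\<^esub> R (mul (\<alpha> x) w)"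
      using left_F[of x "p y" w] x yz w p(1)
      by (simp add: isotopy[symmetric] mul_closed \<alpha>_closed)
    then have "P x \<otimes>\<^bsub>H\<^esub> R (y \<otimes>\<^bsub>H\<^esub> z) = P (mul x (p y)) \<otimes>\<^bsub>H\<^esub> R z"
      by (simp only: 1 2)
    then show ?thesis
      unfolding A_def using x yz PQ RQ p mul_closed closed carrier
      by (metis H.inv_closed H.inv_solve_left H.m_assoc H.m_closed)
  qed
  with R A carrier show ?thesis
    by (intro H.iso_of_left_factorization) auto
qed

text \<open>
  The mirror image: the right F-law at one \<open>x\<close> separates the variables on the side of \<open>P\<close>, the
  constant to be absorbed now being \<open>R (\<beta> x)\<close>.
\<close>

lemma right_F_principal_isotope_iso:
  assumes "right_F_quasigroup Q mul" "group H" and carrier: "carrier H = Q"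
    and P: "bij_betw P Q Q" and R: "bij_betw R Q Q"
    and isotopy: "\<And>x y. x \<in> Q \<Longrightarrow> y \<in> Q \<Longrightarrow> mul x y = P x \<otimes>\<^bsub>H\<^esub> R y"
  shows "(\<lambda>y. P y \<otimes>\<^bsub>H\<^esub> inv\<^bsub>H\<^esub> (P \<one>\<^bsub>H\<^esub>)) \<in> iso H H"
proof -
  interpret right_F_quasigroup Q mul by fact
  interpret H: group H by fact
  note closed = H.m_closed[unfolded carrier] H.inv_closed[unfolded carrier]
  have PQ: "P x \<in> Q" and RQ: "R x \<in> Q" if "x \<in> Q" for x
    using that P R bij_betw_apply by metis+
  obtain x where x: "x \<in> Q"
    using nonempty by blast
  define k where "k = R (\<beta> x)"
  have k: "k \<in> Q"
    unfolding k_def using x by (simp add: RQ \<beta>_closed)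
  define r where "r y = inv_into Q R (k \<otimes>\<^bsub>H\<^esub> y)" for y
  have r: "r y \<in> Q" "R (r y) = k \<otimes>\<^bsub>H\<^esub> y" if "y \<in> Q" for y
    using that k closed R unfolding r_def bij_betw_def
    by (auto intro: inv_into_into f_inv_into_f)
  define B where "B y = R (mul (r y) x) \<otimes>\<^bsub>H\<^esub> inv\<^bsub>H\<^esub> (R x)" for y
  have B: "B y \<in> carrier H" if "y \<in> carrier H" for y
    using that x by (simp add: B_def carrier RQ r mul_closed closed)
  have "P (z \<otimes>\<^bsub>H\<^esub> y) = P z \<otimes>\<^bsub>H\<^esub> B y" if z: "z \<in> carrier H" and y: "y \<in> carrier H" for z y
  proof -
    obtain w where w: "w \<in> Q" "P w = z \<otimes>\<^bsub>H\<^esub> inv\<^bsub>H\<^esub> k"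
      using P z k closed carrier unfolding bij_betw_def by (metis imageE)
    have yz: "y \<in> Q" "z \<in> Q" using y z carrier by simp_all
    have "z \<otimes>\<^bsub>H\<^esub> inv\<^bsub>H\<^esub> k \<otimes>\<^bsub>H\<^esub> (k \<otimes>\<^bsub>H\<^esub> y) = z \<otimes>\<^bsub>H\<^esub> y"
      using yz k by (simp add: H.mult_inv_mult_cancel carrier)
    then have 1: "mul w (r y) = z \<otimes>\<^bsub>H\<^esub> y"
      using isotopy r yz w by simp
    have "z \<otimes>\<^bsub>H\<^esub> inv\<^bsub>H\<^esub> k \<otimes>\<^bsub>H\<^esub> k = z"
      using yz k H.m_assoc[of z "inv\<^bsub>H\<^esub> k" k] H.l_inv[of k] H.r_one[of z]
      by (simp add: carrier closed)
    then have 2: "mul w (\<beta> x) = z"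
      using isotopy[of w "\<beta> x"] \<beta>_closed x w by (simp add: k_def)
    have "P (mul w (r y)) \<otimes>\<^bsub>H\<^esub> R x = P (mul w (\<beta> x)) \<otimes>\<^bsub>H\<^esub> R (mul (r y) x)"
      using right_F[of x "r y" w] x yz w r(1)
      by (simp add: isotopy[symmetric] mul_closed \<beta>_closed)
    then have "P (z \<otimes>\<^bsub>H\<^esub> y) \<otimes>\<^bsub>H\<^esub> R x = P z \<otimes>\<^bsub>H\<^esub> R (mul (r y) x)"
      by (simp only: 1 2)
    then have "P (z \<otimes>\<^bsub>H\<^esub> y) = P z \<otimes>\<^bsub>H\<^esub> R (mul (r y) x) \<otimes>\<^bsub>H\<^esub> inv\<^bsub>H\<^esub> (R x)"
      using x yz PQ RQ r mul_closed closed carrier by (metis H.inv_solve_right)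
    then show ?thesis
      unfolding B_def using x yz by (simp add: H.m_assoc carrier PQ RQ r(1) mul_closed closed)
  qed
  with P B carrier show ?thesis
    by (intro H.iso_of_right_factorization) auto
qed

theorem corollary4p3:
  fixes Q :: "'a set" and mul :: "'a \<Rightarrow> 'a \<Rightarrow> 'a"
  assumes "FG_quasigroup TYPE('b) Q mul"
  shows "\<exists>H :: 'a monoid. group H \<and> carrier H = Q \<and>
           (\<exists>f\<in>iso H H. \<exists>g\<in>iso H H. \<exists>e\<in>Q.
              \<forall>x\<in>Q. \<forall>y\<in>Q. mul x y = f x \<otimes>\<^bsub>H\<^esub> e \<otimes>\<^bsub>H\<^esub> g y)"
proof -
  from assms obtain G :: "'b monoid" where "F_quasigroup Q mul" and G: "isotopic_to_group Q mul G"
    unfolding FG_quasigroup_def by blast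
  interpret F_quasigroup Q mul by fact
  from G obtain H :: "'a monoid" and P R where H: "group H" "carrier H = Q"
    and P: "bij_betw P Q Q" and R: "bij_betw R Q Q"
    and isotopy: "\<And>x y. x \<in> Q \<Longrightarrow> y \<in> Q \<Longrightarrow> mul x y = P x \<otimes>\<^bsub>H\<^esub> R y"
    by (rule principal_isotope) blast
  interpret H: group H by fact
  define f where "f x = P x \<otimes>\<^bsub>H\<^esub> inv\<^bsub>H\<^esub> (P \<one>\<^bsub>H\<^esub>)" for x
  define g where "g y = inv\<^bsub>H\<^esub> (R \<one>\<^bsub>H\<^esub>) \<otimes>\<^bsub>H\<^esub> R y" for y
  have "f \<in> iso H H"
    unfolding f_def[abs_def]
    by (rule right_F_principal_isotope_iso[OF right_F_quasigroup_axioms H P R isotopy])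
  moreover have "g \<in> iso H H"
    unfolding g_def[abs_def]
    by (rule left_F_principal_isotope_iso[OF left_F_quasigroup_axioms H P R isotopy])
  moreover have PH: "P x \<in> carrier H" and RH: "R x \<in> carrier H" if "x \<in> carrier H" for x
    using that P R H(2) bij_betw_apply by metis+
  then have "P \<one>\<^bsub>H\<^esub> \<otimes>\<^bsub>H\<^esub> R \<one>\<^bsub>H\<^esub> \<in> Q"
    using H(2) by auto
  moreover have "mul x y = f x \<otimes>\<^bsub>H\<^esub> (P \<one>\<^bsub>H\<^esub> \<otimes>\<^bsub>H\<^esub> R \<one>\<^bsub>H\<^esub>) \<otimes>\<^bsub>H\<^esub> g y"
    if "x \<in> Q" "y \<in> Q" for x y
  proof -
    have "x \<in> carrier H" "y \<in> carrier H"
      using that H(2) by simp_all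
    then show ?thesis
      using that by (simp add: isotopy f_def g_def H.mult_inv_mult_cancel PH RH)
  qed
  ultimately show ?thesis
    using H by blast
qed

end
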